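(* Let $E$ and $F$ be Banach spaces. A series $\sum_{n=1}^\infty T_n$ with summands in $\mathcal{L}(E,F)$ is convergent in the norm topology of $\mathcal{L}(E,F)$ provided it is independently convergent. In particular, every i-measure (with values in $\mathcal{L}(E,F)$) is a vector measure.
   Context: Banach spaces are over a fixed field $\mathbb{K}$ of real or complex numbers; $\mathcal{L}(E,F)$ is the Banach space of continuous linear operators $E\to F$. For $T_n\in\mathcal{L}(E,F)$, the series $\sum_{n=1}^\infty T_n$ is independently convergent if $\sum_{n=1}^\infty T_nx_n$ converges in the norm topology of $F$ for every bounded sequence $(x_n)$ of elements of $E$. A set function $\mu\colon\mathfrak{M}\to\mathcal{L}(E,F)$, where $\mathfrak{M}$ is a $\sigma$-algebra of subsets of a set $Z$, is an i-measure if for any sequence of pairwise disjoint sets $A_n\in\mathfrak{M}$, $\mu(\bigcup_n A_n)x=\sum_n\mu(A_n)x$ for each $x\in E$ and the series $\sum_n\mu(A_n)$ is independently convergent. A set function $\mu\colon\mathfrak{M}\to G$ with $G$ a Banach space (here $G=\mathcal{L}(E,F)$) is a vector measure if $\psi\circ\mu$ is a (countably additive) scalar-valued measure for every $\psi\in G^*$; equivalently, $\mu(\bigcup_n A_n)=\sum_n\mu(A_n)$ with convergence in the norm of $G$ for any sequence of pairwise disjoint $A_n\in\mathfrak{M}$. *)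

theory Defs
  imports "HOL-Analysis.Analysis"
begin

text \<open>
  The scalar field, real or complex. The distribution has no complex normed spaces, so Banach
  spaces over the scalar field are rendered as types of class \<^class>\<open>banach\<close> together with an
  explicit scalar multiplication extending \<^const>\<open>scaleR\<close>.
\<close>

class real_or_complex = real_normed_field +
  assumes isometric_to_real_or_complex:
    "(\<exists>\<phi> :: 'a \<Rightarrow> real. bij \<phi> \<and> (\<forall>a b. \<phi> (a + b) = \<phi> a + \<phi> b) \<and>
        (\<forall>a b. \<phi> (a * b) = \<phi> a * \<phi> b) \<and> (\<forall>a. norm (\<phi> a) = norm a)) \<or>
     (\<exists>\<phi> :: 'a \<Rightarrow> complex. bij \<phi> \<and> (\<forall>a b. \<phi> (a + b) = \<phi> a + \<phi> b) \<and>
        (\<forall>a b. \<phi> (a * b) = \<phi> a * \<phi> b) \<and> (\<forall>a. norm (\<phi> a) = norm a))"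

instance real :: real_or_complex
  by standard (rule disjI1, rule exI[of _ id], simp)

instance complex :: real_or_complex
  by standard (rule disjI2, rule exI[of _ id], simp)

locale banach_over = vector_space scale
  for scale :: "'k::real_or_complex \<Rightarrow> 'e::banach \<Rightarrow> 'e" +
  assumes norm_scale: "norm (scale c x) = norm c * norm x"
    and scale_of_real: "scale (of_real r) x = r *\<^sub>R x"

text \<open>
  The space $\mathcal{L}(E,F)$ is a subset of the real-linear bounded operators, whose norm and
  topology it inherits; the operator norm does not depend on the scalar field.
\<close>

definition operators ::
    "('k::real_or_complex \<Rightarrow> 'e::banach \<Rightarrow> 'e) \<Rightarrow> ('k \<Rightarrow> 'f::banach \<Rightarrow> 'f) \<Rightarrow> ('e \<Rightarrow>\<^sub>L 'f) set"
  where "operators sE sF = {T. Vector_Spaces.linear sE sF (blinfun_apply T)}"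

definition operator_scale ::
    "('k::real_or_complex \<Rightarrow> 'f::banach \<Rightarrow> 'f) \<Rightarrow> 'k \<Rightarrow> ('e::banach \<Rightarrow>\<^sub>L 'f) \<Rightarrow> ('e \<Rightarrow>\<^sub>L 'f)"
  where "operator_scale sF c T = Blinfun (\<lambda>x. sF c (blinfun_apply T x))"

lemma (in banach_over) bounded_linear_scale: "bounded_linear (scale c)"
proof (rule bounded_linear_intro[where K = "norm c"])
  fix x y and r :: real
  show "scale c (x + y) = scale c x + scale c y"
    by (rule scale_right_distrib)
  show "scale c (r *\<^sub>R x) = r *\<^sub>R scale c x"
    by (metis scale_of_real scale_left_commute)
  show "norm (scale c x) \<le> norm x * norm c"
    by (simp add: norm_scale mult.commute)
qed

lemma operator_scale_apply:
  assumes "banach_over sF"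
  shows "blinfun_apply (operator_scale sF c T) x = sF c (blinfun_apply T x)"
  unfolding operator_scale_def
  by (subst bounded_linear_Blinfun_apply)
    (auto intro: bounded_linear_compose[OF banach_over.bounded_linear_scale[OF assms]]
      blinfun.bounded_linear_right)

lemma operator_scale_in_operators:
  assumes "banach_over sE" "banach_over sF" "T \<in> operators sE sF"
  shows "operator_scale sF c T \<in> operators sE sF"
proof -
  interpret E: banach_over sE by fact
  interpret F: banach_over sF by fact
  interpret T: Vector_Spaces.linear sE sF "blinfun_apply T"
    using assms(3) by (simp add: operators_def)
  show ?thesis
    unfolding operators_def mem_Collect_eq
    by unfold_locales
      (simp_all add: operator_scale_apply[OF assms(2)] T.add T.scale F.scale_right_distrib
        mult.commute)
qed

definition indep_convergent :: "(nat \<Rightarrow> 'e::banach \<Rightarrow>\<^sub>L 'f::banach) \<Rightarrow> bool"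
  where "indep_convergent T \<longleftrightarrow>
    (\<forall>x :: nat \<Rightarrow> 'e. bounded (range x) \<longrightarrow> summable (\<lambda>n. blinfun_apply (T n) (x n)))"

definition i_measure ::
    "('k::real_or_complex \<Rightarrow> 'e::banach \<Rightarrow> 'e) \<Rightarrow> ('k \<Rightarrow> 'f::banach \<Rightarrow> 'f) \<Rightarrow>
      'z set set \<Rightarrow> ('z set \<Rightarrow> 'e \<Rightarrow>\<^sub>L 'f) \<Rightarrow> bool"
  where "i_measure sE sF M \<mu> \<longleftrightarrow>
    \<mu> \<in> M \<rightarrow> operators sE sF \<and>
    (\<forall>A :: nat \<Rightarrow> 'z set. range A \<subseteq> M \<longrightarrow> disjoint_family A \<longrightarrow>
      (\<forall>x. (\<lambda>n. blinfun_apply (\<mu> (A n)) x) sums blinfun_apply (\<mu> (\<Union>n. A n)) x) \<and>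
      indep_convergent (\<lambda>n. \<mu> (A n)))"

text \<open>
  Continuous functionals on, and vector measures with values in, a normed space given by a
  carrier \<open>G\<close> and a scalar multiplication \<open>sG\<close>. Functionals are constrained on \<open>G\<close> only.
\<close>

definition continuous_dual ::
    "('k::real_or_complex \<Rightarrow> 'g::real_normed_vector \<Rightarrow> 'g) \<Rightarrow> 'g set \<Rightarrow> ('g \<Rightarrow> 'k) set"
  where "continuous_dual sG G = {\<psi>.
    (\<forall>x\<in>G. \<forall>y\<in>G. \<psi> (x + y) = \<psi> x + \<psi> y) \<and>
    (\<forall>c. \<forall>x\<in>G. \<psi> (sG c x) = c * \<psi> x) \<and>
    continuous_on G \<psi>}"

definition scalar_measure :: "'z set set \<Rightarrow> ('z set \<Rightarrow> 'k::real_or_complex) \<Rightarrow> bool"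
  where "scalar_measure M \<nu> \<longleftrightarrow>
    (\<forall>A :: nat \<Rightarrow> 'z set. range A \<subseteq> M \<longrightarrow> disjoint_family A \<longrightarrow>
      (\<lambda>n. \<nu> (A n)) sums \<nu> (\<Union>n. A n))"

definition vector_measure ::
    "('k::real_or_complex \<Rightarrow> 'g::real_normed_vector \<Rightarrow> 'g) \<Rightarrow> 'g set \<Rightarrow>
      'z set set \<Rightarrow> ('z set \<Rightarrow> 'g) \<Rightarrow> bool"
  where "vector_measure sG G M \<mu> \<longleftrightarrow>
    \<mu> \<in> M \<rightarrow> G \<and> (\<forall>\<psi> \<in> continuous_dual sG G. scalar_measure M (\<psi> \<circ> \<mu>))"

end

theory Submission
  imports Defs
begin

text \<open>
  If the partial sums of an independently convergent series were not Cauchy in operator norm, there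
  would be infinitely many disjoint blocks of the series whose sums have norm at least some
  \<open>e > 0\<close>. Feeding to all operators of a block one unit-ball vector on which the block sum exceeds
  \<open>e / 2\<close> gives a bounded sequence along which the series diverges. For an i-measure, the norm sum
  obtained in this way agrees pointwise with the value on the union.
\<close>

text \<open>A constant below the operator norm cannot bound the operator, so it fails at some
  \<open>y\<close>; dividing \<open>y\<close> by its norm keeps the strict inequality.\<close>

lemma blinfun_unit_ball_witness:
  fixes B :: "'e::real_normed_vector \<Rightarrow>\<^sub>L 'f::real_normed_vector"
  assumes "0 \<le> c" and "c < norm B"
  obtains x where "norm x \<le> 1" and "c < norm (blinfun_apply B x)"
proof -
  obtain y where y: "c * norm y < norm (blinfun_apply B y)"
    using norm_blinfun_bound[of c B] assms by (meson not_le)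
  then have "y \<noteq> 0"
    by auto
  show thesis
  proof
    show "norm (y /\<^sub>R norm y) \<le> 1"
      using \<open>y \<noteq> 0\<close> by simp
    show "c < norm (blinfun_apply B (y /\<^sub>R norm y))"
      using y \<open>y \<noteq> 0\<close> by (simp add: blinfun.scaleR_right field_simps)
  qed
qed

lemma indep_convergent_imp_summable:
  fixes T :: "nat \<Rightarrow> 'e::banach \<Rightarrow>\<^sub>L 'f::banach"
  assumes "indep_convergent T"
  shows "summable T"
proof (rule ccontr)
  assume "\<not> summable T"
  \<comment> \<open>The operator space is complete, so divergence is failure of the Cauchy
    criterion: beyond every \<open>N\<close> starts a block of norm at least
    \<open>e\<close>.\<close>
  then obtain e where "e > 0"
    and "\<forall>N. \<exists>m\<ge>N. \<exists>n. e \<le> norm (sum T {m..<n})"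
    unfolding summable_Cauchy by (meson not_le)
  then obtain p q where p: "\<And>N. N \<le> p N"
    and e: "\<And>N. e \<le> norm (sum T {p N..<q N})"
    by metis
  \<comment> \<open>An empty block would have sum zero. Hence \<open>N < q N\<close>, which makes
    the iterates of \<open>q\<close> strictly increasing.\<close>
  have pq: "p N < q N" for N
  proof (rule ccontr)
    assume "\<not> p N < q N"
    then have "sum T {p N..<q N} = 0"
      by simp
    with e[of N] \<open>e > 0\<close> show False
      by simp
  qed
  have "\<exists>x. norm x \<le> 1 \<and> e / 2 < norm (blinfun_apply (sum T {p N..<q N}) x)" for N
  proof -
    have "e / 2 < norm (sum T {p N..<q N})"
      using e[of N] \<open>e > 0\<close> by linarith
    moreover have "0 \<le> e / 2"
      using \<open>e > 0\<close> by simp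
    ultimately show ?thesis
      using blinfun_unit_ball_witness by blast
  qed
  then obtain x where x1: "\<And>N. norm (x N) \<le> 1"
    and xe: "\<And>N. e / 2 < norm (blinfun_apply (sum T {p N..<q N}) (x N))"
    by metis
  \<comment> \<open>The block chosen for \<open>s j\<close> lies in the interval from
    \<open>s j\<close> up to, but excluding, \<open>s (Suc j)\<close>. These intervals are disjoint,
    hence so are the blocks.\<close>
  define s where "s j = (q ^^ j) 0" for j
  have s_Suc: "s (Suc j) = q (s j)" for j
    by (simp add: s_def)
  have s: "strict_mono s"
    unfolding strict_mono_Suc_iff s_Suc using le_less_trans[OF p pq] by simp
  \<comment> \<open>The least \<open>j\<close> is the number of the interval containing
    \<open>k\<close>, so \<open>y\<close> is constant on each interval, including the indices before
    its block.\<close>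
  define y where "y k = x (s (LEAST j. k < s (Suc j)))" for k
  have y: "y k = x (s j)" if "s j \<le> k" "k < s (Suc j)" for j k
  proof -
    have "j \<le> i" if "k < s (Suc i)" for i
      using \<open>s j \<le> k\<close> that strict_mono_less[OF s, of j "Suc i"] by linarith
    with that have "(LEAST j. k < s (Suc j)) = j"
      by (intro Least_equality)
    then show ?thesis
      by (simp add: y_def)
  qed
  have "bounded (range y)"
    by (rule boundedI[where B = 1]) (auto simp: y_def x1)
  with assms have "summable (\<lambda>k. blinfun_apply (T k) (y k))"
    by (simp add: indep_convergent_def)
  then obtain N where
    N: "\<And>m n. N \<le> m \<Longrightarrow> norm (\<Sum>k=m..<n. blinfun_apply (T k) (y k)) < e / 2"
    unfolding summable_Cauchy using \<open>e > 0\<close> by (meson half_gt_zero)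
  \<comment> \<open>The Cauchy threshold \<open>N\<close> doubles as an interval number: block
    \<open>N\<close> starts at \<open>p (s N)\<close>, and
    \<open>N \<le> s N \<le> p (s N)\<close>.\<close>
  let ?m = "p (s N)" and ?n = "q (s N)"
  have "(\<Sum>k=?m..<?n. blinfun_apply (T k) (y k)) = (\<Sum>k=?m..<?n. blinfun_apply (T k) (x (s N)))"
  proof (rule sum.cong[OF refl])
    fix k assume "k \<in> {?m..<?n}"
    then have "y k = x (s N)"
      using p[of "s N"] by (intro y) (auto simp: s_Suc)
    then show "blinfun_apply (T k) (y k) = blinfun_apply (T k) (x (s N))"
      by simp
  qed
  also have "\<dots> = blinfun_apply (sum T {?m..<?n}) (x (s N))"
    by (simp add: blinfun.sum_left)
  finally have "e / 2 < norm (\<Sum>k=?m..<?n. blinfun_apply (T k) (y k))"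
    using xe by simp
  moreover have "N \<le> ?m"
    using order_trans[OF strict_mono_imp_increasing[OF s] p] .
  ultimately show False
    using N[of ?m ?n] by linarith
qed

lemma sums_blinfun_apply:
  assumes "T sums S"
  shows "(\<lambda>n. blinfun_apply (T n) x) sums blinfun_apply S x"
  using assms by (rule bounded_linear.sums[OF blinfun.bounded_linear_left])

text \<open>Additivity is built into the type of bounded operators, which leaves only homogeneity
  over the scalar field.\<close>

lemma operators_iff:
  assumes "banach_over sE" and "banach_over sF"
  shows "T \<in> operators sE sF \<longleftrightarrow>
    (\<forall>c x. blinfun_apply T (sE c x) = sF c (blinfun_apply T x))"
proof -
  interpret E: banach_over sE by fact
  interpret F: banach_over sF by fact
  show ?thesis
    unfolding operators_def Vector_Spaces.linear_iff
    using E.vector_space_axioms F.vector_space_axioms by (simp add: blinfun.add_right)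
qed

text \<open>Homogeneity survives limits because scaling by a fixed \<open>c\<close> is continuous on
  the target space.\<close>

lemma sums_in_operators:
  assumes E: "banach_over sE" and F: "banach_over sF"
    and T: "range T \<subseteq> operators sE sF" and "T sums S"
  shows "S \<in> operators sE sF"
  unfolding operators_iff[OF E F]
proof (intro allI)
  fix c x
  interpret F: banach_over sF by fact
  have "(\<lambda>n. sF c (blinfun_apply (T n) x)) sums sF c (blinfun_apply S x)"
    by (intro bounded_linear.sums[OF F.bounded_linear_scale] sums_blinfun_apply assms)
  moreover have "blinfun_apply (T n) (sE c x) = sF c (blinfun_apply (T n) x)" for n
    using T operators_iff[OF E F] by blast
  ultimately have "(\<lambda>n. blinfun_apply (T n) (sE c x)) sums sF c (blinfun_apply S x)"
    by simp
  with sums_blinfun_apply[OF \<open>T sums S\<close>] show "blinfun_apply S (sE c x) = sF c (blinfun_apply S x)"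
    by (rule sums_unique2)
qed

text \<open>Since \<psi> is controlled on \<open>G\<close> only, the partial sums and the limit must
  all be kept inside \<open>G\<close>.\<close>

lemma continuous_dual_sums:
  assumes \<psi>: "\<psi> \<in> continuous_dual sG G"
    and zero: "0 \<in> G" and add: "\<And>x y. x \<in> G \<Longrightarrow> y \<in> G \<Longrightarrow> x + y \<in> G"
    and T: "\<And>n. T n \<in> G" and "S \<in> G" and "T sums S"
  shows "(\<lambda>n. \<psi> (T n)) sums \<psi> S"
proof -
  have \<psi>_add: "\<psi> (x + y) = \<psi> x + \<psi> y" if "x \<in> G" "y \<in> G" for x y
    using \<psi> that by (simp add: continuous_dual_def)
  have \<psi>_zero: "\<psi> 0 = 0"
    using \<psi>_add[OF zero zero] by simp
  have G: "sum T {..<n} \<in> G" for n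
    by (induction n) (simp_all add: zero add T)
  have \<psi>_sum: "\<psi> (sum T {..<n}) = (\<Sum>k<n. \<psi> (T k))" for n
    by (induction n) (simp_all add: \<psi>_zero \<psi>_add G T)
  have "continuous_on G \<psi>"
    using \<psi> by (simp add: continuous_dual_def)
  then have "(\<lambda>n. \<psi> (sum T {..<n})) \<longlonglongrightarrow> \<psi> S"
    using \<open>T sums S\<close> \<open>S \<in> G\<close> G
    by (auto intro: continuous_on_tendsto_compose simp: sums_def)
  then show ?thesis
    by (simp add: sums_def \<psi>_sum)
qed

lemma i_measure_sums:
  assumes "i_measure sE sF M \<mu>" and "range A \<subseteq> M" and "disjoint_family A"
  shows "(\<lambda>n. \<mu> (A n)) sums \<mu> (\<Union>n. A n)"
proof -
  have pt: "(\<lambda>n. blinfun_apply (\<mu> (A n)) x) sums blinfun_apply (\<mu> (\<Union>n. A n)) x" for x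
    using assms by (simp add: i_measure_def)
  have ind: "indep_convergent (\<lambda>n. \<mu> (A n))"
    using assms by (simp add: i_measure_def)
  obtain S where S: "(\<lambda>n. \<mu> (A n)) sums S"
    using indep_convergent_imp_summable[OF ind] by (auto simp: summable_def)
  have "S = \<mu> (\<Union>n. A n)"
    by (rule blinfun_eqI) (rule sums_unique2[OF sums_blinfun_apply[OF S] pt])
  with S show ?thesis
    by simp
qed

lemma i_measure_imp_vector_measure:
  assumes E: "banach_over sE" and F: "banach_over sF"
    and "sigma_algebra Z M" and \<mu>: "i_measure sE sF M \<mu>"
  shows "vector_measure (operator_scale sF) (operators sE sF) M \<mu>"
  unfolding vector_measure_def scalar_measure_def comp_def
proof (intro conjI ballI allI impI)
  interpret F: banach_over sF by fact
  show L: "\<mu> \<in> M \<rightarrow> operators sE sF"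
    using \<mu> by (simp add: i_measure_def)
  fix \<psi> and A :: "nat \<Rightarrow> _"
  assume \<psi>: "\<psi> \<in> continuous_dual (operator_scale sF) (operators sE sF)"
    and A: "range A \<subseteq> M" and "disjoint_family A"
  show "(\<lambda>n. \<psi> (\<mu> (A n))) sums \<psi> (\<mu> (\<Union>n. A n))"
  proof (rule continuous_dual_sums[OF \<psi>])
    show "0 \<in> operators sE sF"
      by (simp add: operators_iff[OF E F])
    show "U + V \<in> operators sE sF" if "U \<in> operators sE sF" "V \<in> operators sE sF" for U V
      using that by (simp add: operators_iff[OF E F] blinfun.add_left F.scale_right_distrib)
    show "\<mu> (A n) \<in> operators sE sF" for n
      using A L by blast
    \<comment> \<open>Closure of \<open>M\<close> under countable unions puts the limit into the
      carrier, where \<psi> is continuous.\<close>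
    show "\<mu> (\<Union>n. A n) \<in> operators sE sF"
      using sigma_algebra.countable_nat_UN[OF \<open>sigma_algebra Z M\<close> A] L by blast
    show "(\<lambda>n. \<mu> (A n)) sums \<mu> (\<Union>n. A n)"
      by (rule i_measure_sums) fact+
  qed
qed

theorem lemma4p3:
  fixes sE :: "'k::real_or_complex \<Rightarrow> 'e::banach \<Rightarrow> 'e"
    and sF :: "'k \<Rightarrow> 'f::banach \<Rightarrow> 'f"
  assumes "banach_over sE" and "banach_over sF"
  shows "(\<forall>T :: nat \<Rightarrow> 'e \<Rightarrow>\<^sub>L 'f. range T \<subseteq> operators sE sF \<longrightarrow> indep_convergent T \<longrightarrow>
            (\<exists>S \<in> operators sE sF. T sums S)) \<and>
         (\<forall>(Z :: 'z set) M (\<mu> :: 'z set \<Rightarrow> 'e \<Rightarrow>\<^sub>L 'f).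
            sigma_algebra Z M \<longrightarrow> i_measure sE sF M \<mu> \<longrightarrow>
            vector_measure (operator_scale sF) (operators sE sF) M \<mu>)"
proof (intro conjI allI impI)
  fix T :: "nat \<Rightarrow> 'e \<Rightarrow>\<^sub>L 'f"
  assume T: "range T \<subseteq> operators sE sF" "indep_convergent T"
  \<comment> \<open>This sum is so far only a real-linear operator; its linearity over the scalar
    field comes from \<open>sums_in_operators\<close>.\<close>
  then have "T sums suminf T"
    by (intro summable_sums indep_convergent_imp_summable)
  with sums_in_operators[OF assms T(1)] show "\<exists>S \<in> operators sE sF. T sums S"
    by blast
next
  fix Z :: "'z set" and M and \<mu> :: "'z set \<Rightarrow> 'e \<Rightarrow>\<^sub>L 'f"
  assume "sigma_algebra Z M" "i_measure sE sF M \<mu>"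
  with assms show "vector_measure (operator_scale sF) (operators sE sF) M \<mu>"
    by (rule i_measure_imp_vector_measure)
qed

end
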